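(* Let $\mathbb K$ be $\mathbb C$ or $\mathbb R$ and let $q\in\mathbb K$ be generic (nonzero and not a root of unity). Let $U$ be the vector space over $\mathbb K$ with basis $\{e_k\}_{k\in\mathbb Z}$, let $I\subset U^{\otimes 2}$ be the span of the elements $q^{m+1}e_m\otimes e_n-q^{n+1}e_n\otimes e_m$, $m,n\in\mathbb Z$, and let $U(\mathcal W_q)$ be the enveloping algebra of the $q$-Witt algebra, i.e. the quotient of the tensor algebra $T(U)$ by the two-sided ideal generated by the elements $$q^{m+1}e_m\otimes e_n-q^{n+1}e_n\otimes e_m-\big((n+1)_q-(m+1)_q\big)e_{m+n},\qquad m,n\in\mathbb Z.$$ Then the PBW property fails for $U(\mathcal W_q)$: the associated graded algebra $\mathrm{Gr}(U(\mathcal W_q))$ is not canonically isomorphic to the quadratic algebra $T(U)/\langle I\rangle$, i.e. the canonical surjective homomorphism $T(U)/\langle I\rangle\to\mathrm{Gr}(U(\mathcal W_q))$ is not an isomorphism.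
   Context: Here $k_q=\frac{q^k-1}{q-1}$ for $k\in\mathbb Z$; $\langle I\rangle$ is the two-sided ideal generated by $I$; $U$ and $U^{\otimes k}$ consist of finite linear combinations only. $\mathrm{Gr}(U(\mathcal W_q))$ is the graded algebra associated with the filtration of $U(\mathcal W_q)$ induced by the degree filtration of $T(U)$ (each $e_k$ having degree 1); the canonical homomorphism $T(U)/\langle I\rangle\to\mathrm{Gr}(U(\mathcal W_q))$ sends $e_k$ to the class of $e_k$ in degree 1. *)

theory Defs
  imports
    Complex_Main
    "HOL-Library.Poly_Mapping"
    "HOL-Algebra.QuotRing"
    "HOL-Algebra.Module"
begin

section \<open>Associative algebras over a field\<close>

text \<open>
  Associative unital algebras are represented by the \<open>module\<close> records of HOL-Algebra
  (a ring record together with \<open>smult\<close>); the scalars form a type. The locale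
  \<open>algebra\<close> of the library cannot be used, since it requires commutativity, and
  \<open>Quot\<close> forgets the scalar multiplication, which is restored here.
\<close>

definition quot_alg :: "('k, 'a) module \<Rightarrow> 'a set \<Rightarrow> ('k, 'a set) module" where
  "quot_alg A J =
    \<lparr>carrier = carrier (A Quot J), mult = mult (A Quot J), one = one (A Quot J),
     zero = zero (A Quot J), add = add (A Quot J),
     smult = (\<lambda>c X. \<Union>x\<in>X. J +>\<^bsub>A\<^esub> (c \<odot>\<^bsub>A\<^esub> x))\<rparr>"

definition alg_hom :: "('k, 'a) module \<Rightarrow> ('k, 'b) module \<Rightarrow> ('a \<Rightarrow> 'b) set" where
  "alg_hom A B =
    {h \<in> ring_hom A B. \<forall>c. \<forall>x\<in>carrier A. h (c \<odot>\<^bsub>A\<^esub> x) = c \<odot>\<^bsub>B\<^esub> h x}"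

definition alg_iso :: "('k, 'a) module \<Rightarrow> ('k, 'b) module \<Rightarrow> ('a \<Rightarrow> 'b) set" where
  "alg_iso A B = {h \<in> alg_hom A B. bij_betw h (carrier A) (carrier B)}"


section \<open>The graded algebra associated with a filtration\<close>

text \<open>
  \<open>F\<close> is an increasing multiplicative filtration with \<open>F p = {0}\<close> for \<open>p < 0\<close>. An
  element of \<open>Gr\<close>, the direct sum of the \<open>F p / F (p - 1)\<close> over \<open>p \<ge> 0\<close>, is
  a finitely supported family of cosets. The product of the classes of \<open>a \<in> F i\<close> and
  \<open>b \<in> F j\<close> is the class of \<open>a b\<close> in degree \<open>i + j\<close>, so the component of
  degree \<open>p\<close> of \<open>f g\<close> is the class of the sum of the \<open>x i y (p - i)\<close> for any
  representatives \<open>x\<close> of \<open>f\<close> and \<open>y\<close> of \<open>g\<close>.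
\<close>

definition gr_class ::
    "('k, 'a) module \<Rightarrow> (int \<Rightarrow> 'a set) \<Rightarrow> nat \<Rightarrow> 'a \<Rightarrow> nat \<Rightarrow> 'a set" where
  "gr_class A F n x =
    (\<lambda>p. if p = n then F (int p - 1) +>\<^bsub>A\<^esub> x else F (int p - 1))"

definition assoc_graded ::
    "('k, 'a) module \<Rightarrow> (int \<Rightarrow> 'a set) \<Rightarrow> ('k, nat \<Rightarrow> 'a set) module" where
  "assoc_graded A F =
    \<lparr>carrier = {f. (\<forall>p. f p \<in> {F (int p - 1) +>\<^bsub>A\<^esub> x | x. x \<in> F (int p)})
                 \<and> finite {p. f p \<noteq> F (int p - 1)}},
     mult = (\<lambda>f g p. \<Union>(x, y)\<in>{(x, y). (\<forall>i. x i \<in> f i) \<and> (\<forall>i. y i \<in> g i)}.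
                F (int p - 1) +>\<^bsub>A\<^esub> (\<Oplus>\<^bsub>A\<^esub>i\<in>{..p}. x i \<otimes>\<^bsub>A\<^esub> y (p - i))),
     one = gr_class A F 0 \<one>\<^bsub>A\<^esub>,
     zero = (\<lambda>p. F (int p - 1)),
     add = (\<lambda>f g p. f p <+>\<^bsub>A\<^esub> g p),
     smult = (\<lambda>c f p. \<Union>x\<in>f p. F (int p - 1) +>\<^bsub>A\<^esub> (c \<odot>\<^bsub>A\<^esub> x))\<rparr>"


section \<open>The tensor algebra of the space with basis indexed by the integers\<close>

text \<open>
  The \<open>k\<close>-th tensor power of the space \<open>U\<close> with basis \<open>e_basis m\<close> (\<open>m\<close> an integer) has
  as basis the tensors of \<open>k\<close> basis vectors, i.e. the words of length \<open>k\<close> in the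
  integers. Hence \<open>T(U)\<close> is the space of finitely supported functions on words, and
  its product (concatenation of tensors) is the convolution product of
  \<open>poly_mapping\<close>, which needs words to be an additively written monoid.
\<close>

datatype word = Word (letters: "int list")

instantiation word :: monoid_add
begin

definition zero_word :: word where
  "0 = Word []"

definition plus_word :: "word \<Rightarrow> word \<Rightarrow> word" where
  "v + w = Word (letters v @ letters w)"

instance
  by standard (simp_all add: zero_word_def plus_word_def)

end

type_synonym 'k tensors = "word \<Rightarrow>\<^sub>0 'k"

definition scale :: "'k::field \<Rightarrow> 'k tensors \<Rightarrow> 'k tensors" where
  "scale c x = Poly_Mapping.map ((*) c) x"

definition tensor_alg :: "('k::field, 'k tensors) module" where
  "tensor_alg =
    \<lparr>carrier = UNIV, mult = (*), one = 1, zero = 0, add = (+), smult = scale\<rparr>"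

definition e_basis :: "int \<Rightarrow> 'k::field tensors" where
  "e_basis m = Poly_Mapping.single (Word [m]) 1"

lemma lookup_scale: "Poly_Mapping.lookup (scale c x) w = c * Poly_Mapping.lookup x w"
  by (simp add: scale_def Poly_Mapping.map.rep_eq when_def)

lemma e_times_e: "e_basis m * e_basis n = Poly_Mapping.single (Word [m, n]) 1"
  by (simp add: e_basis_def Poly_Mapping.mult_single plus_word_def)

text \<open>The sum of the tensor powers of \<open>U\<close> of order at most \<open>p\<close>.\<close>

definition deg_le :: "int \<Rightarrow> 'k::field tensors set" where
  "deg_le p = {x. \<forall>w\<in>Poly_Mapping.keys x. int (length (letters w)) \<le> p}"


section \<open>The enveloping algebra of the q-Witt algebra\<close>

definition q_generic :: "'k::field \<Rightarrow> bool" where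
  "q_generic q \<longleftrightarrow> q \<noteq> 0 \<and> (\<forall>n::nat. n > 0 \<longrightarrow> q ^ n \<noteq> 1)"

definition q_int :: "'k::field \<Rightarrow> int \<Rightarrow> 'k" where
  "q_int q k = (q powi k - 1) / (q - 1)"

definition quad_rel :: "'k::field \<Rightarrow> int \<Rightarrow> int \<Rightarrow> 'k tensors" where
  "quad_rel q m n =
    scale (q powi (m + 1)) (e_basis m * e_basis n) - scale (q powi (n + 1)) (e_basis n * e_basis m)"

definition quad_space :: "'k::field \<Rightarrow> 'k tensors set" where
  "quad_space q = Modules.module.span scale {quad_rel q m n | m n. True}"

definition quad_alg :: "'k::field \<Rightarrow> ('k, 'k tensors set) module" where
  "quad_alg q = quot_alg tensor_alg (Idl\<^bsub>tensor_alg\<^esub> (quad_space q))"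

definition witt_rel :: "'k::field \<Rightarrow> int \<Rightarrow> int \<Rightarrow> 'k tensors" where
  "witt_rel q m n =
    quad_rel q m n - scale (q_int q (n + 1) - q_int q (m + 1)) (e_basis (m + n))"

definition witt_ideal :: "'k::field \<Rightarrow> 'k tensors set" where
  "witt_ideal q = Idl\<^bsub>tensor_alg\<^esub> {witt_rel q m n | m n. True}"

definition witt_alg :: "'k::field \<Rightarrow> ('k, 'k tensors set) module" where
  "witt_alg q = quot_alg tensor_alg (witt_ideal q)"

definition witt_filtration :: "'k::field \<Rightarrow> int \<Rightarrow> 'k tensors set set" where
  "witt_filtration q p = {witt_ideal q +>\<^bsub>tensor_alg\<^esub> x | x. x \<in> deg_le p}"

definition gr_witt :: "'k::field \<Rightarrow> ('k, nat \<Rightarrow> 'k tensors set set) module" where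
  "gr_witt q = assoc_graded (witt_alg q) (witt_filtration q)"

text \<open>
  Since the \<open>e_basis k\<close> generate the algebra, the values at these elements determine the
  canonical homomorphism.
\<close>

definition canonical_hom ::
    "'k::field \<Rightarrow> ('k tensors set \<Rightarrow> nat \<Rightarrow> 'k tensors set set) \<Rightarrow> bool" where
  "canonical_hom q \<phi> \<longleftrightarrow>
    \<phi> \<in> alg_hom (quad_alg q) (gr_witt q) \<and>
    (\<forall>k. \<phi> (Idl\<^bsub>tensor_alg\<^esub> (quad_space q) +>\<^bsub>tensor_alg\<^esub> e_basis k) =
         gr_class (witt_alg q) (witt_filtration q) 1 (witt_ideal q +>\<^bsub>tensor_alg\<^esub> e_basis k))"

end

theory Submission
  imports Defs
begin

text \<open>
  Let \<open>\<sigma> : T(U) \<rightarrow> Gr\<close> send a tensor to the family of classes of its homogeneous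
  components. It is a surjective homomorphism which kills the quadratic relations, since
  modulo the Witt ideal these have degree 1; hence it factors through the quadratic algebra,
  and as the \<open>e\<^sub>k\<close> generate, every canonical homomorphism arises from \<open>\<sigma>\<close> in this way.

  The \<open>q\<close>-commutator does not satisfy the Jacobi identity: reordering \<open>e\<^sub>1 e\<^sub>2 e\<^sub>3\<close> in two ways
  produces a homogeneous element \<open>D\<close> of degree 2 in the Witt ideal, so \<open>\<sigma> D = 0\<close>. The
  character of \<open>T(U)\<close> with \<open>e\<^sub>3 \<mapsto> 1\<close> and all other \<open>e\<^sub>k \<mapsto> 0\<close> kills the quadratic relations but
  takes the value \<open>1 - q\<^sup>3 \<noteq> 0\<close> at \<open>D\<close>, so the canonical homomorphism is not injective.
\<close>

subsection \<open>The tensor algebra\<close>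

text \<open>The scalars are the multiples of the empty word, so every ideal of \<open>T(U)\<close>
  is closed under scaling.\<close>

lemma scale_eq_mult: "scale c x = Poly_Mapping.single 0 c * x"
  by (simp add: scale_def mult_map_scale_conv_mult)

lemma scale_add_right: "scale c (x + y) = scale c x + scale c y"
  and scale_diff_right: "scale c (x - y) = scale c x - scale c y"
  and scale_add_left: "scale (c + d) x = scale c x + scale d x"
  and scale_diff_left: "scale (c - d) x = scale c x - scale d x"
  and scale_scale: "scale c (scale d x) = scale (c * d) x"
  and scale_one: "scale 1 x = x"
  by (rule poly_mapping_eqI; simp add: lookup_scale lookup_add lookup_minus algebra_simps)+

lemma scale_mult_left: "scale c x * y = scale c (x * y)"
  by (simp add: scale_eq_mult mult.assoc)

lemma scale_zero [simp]: "scale c 0 = 0"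
  by (simp add: scale_eq_mult)

lemma module_scale: "Modules.module scale"
  by standard (simp_all add: scale_add_right scale_add_left scale_scale scale_one)

text \<open>Reduces identities additive in \<open>x\<close> to multiples of a single word; bilinear
  identities follow by using it once per factor.\<close>

lemma poly_mapping_add_induct [case_names single add]:
  fixes x :: "'a \<Rightarrow>\<^sub>0 'b::comm_monoid_add"
  assumes "\<And>w c. P (Poly_Mapping.single w c)" "\<And>x y. P x \<Longrightarrow> P y \<Longrightarrow> P (x + y)"
  shows "P x"
proof (induction x rule: update_induct)
  case const
  \<comment> \<open>Zero arises as a single term with coefficient 0, at an arbitrary key.\<close>
  show ?case using assms(1)[of undefined 0] by simp
next
  case (update f a b)
  \<comment> \<open>The key \<open>a\<close> is not yet in the support of \<open>f\<close>, so
    updating amounts to adding.\<close>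
  have "Poly_Mapping.update a b f = f + Poly_Mapping.single a b"
    using update.hyps by (intro poly_mapping_eqI)
      (auto simp: lookup_update lookup_add lookup_single in_keys_iff when_def)
  then show ?case using assms update by simp
qed

text \<open>Multiples of the empty word are central, although \<open>T(U)\<close> is not
  commutative; here commutativity of the field enters.\<close>

lemma scale_mult_right: "x * scale c y = scale c (x * (y :: 'k::field tensors))"
proof (induction x rule: poly_mapping_add_induct)
  case (single w d)
  show ?case
    by (simp add: scale_eq_mult mult_single mult.commute [of d c] flip: mult.assoc)
next
  case (add x x')
  then show ?case by (simp add: distrib_right scale_add_right)
qed

section \<open>The degree filtration of the tensor algebra\<close>

lemma deg_le_iff:
  "x \<in> deg_le p \<longleftrightarrow> (\<forall>w. p < int (length (letters w)) \<longrightarrow> Poly_Mapping.lookup x w = 0)"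
  unfolding deg_le_def in_keys_iff mem_Collect_eq Ball_def by (metis not_less)

lemma deg_le_zero: "0 \<in> deg_le p"
  and deg_le_add: "x \<in> deg_le p \<Longrightarrow> y \<in> deg_le p \<Longrightarrow> x + y \<in> deg_le p"
  and deg_le_diff: "x \<in> deg_le p \<Longrightarrow> y \<in> deg_le p \<Longrightarrow> x - y \<in> deg_le p"
  and deg_le_scale: "x \<in> deg_le p \<Longrightarrow> scale c x \<in> deg_le p"
  and deg_le_mono: "x \<in> deg_le p \<Longrightarrow> p \<le> r \<Longrightarrow> x \<in> deg_le r"
  by (simp_all add: deg_le_iff lookup_add lookup_minus lookup_scale)

lemma deg_le_sum: "(\<And>i. i \<in> S \<Longrightarrow> f i \<in> deg_le p) \<Longrightarrow> sum f S \<in> deg_le p"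
  by (induction S rule: infinite_finite_induct) (auto simp: deg_le_zero deg_le_add)

lemma deg_le_mult: "x \<in> deg_le p \<Longrightarrow> y \<in> deg_le r \<Longrightarrow> x * y \<in> deg_le (p + r)"
proof -
  assume "x \<in> deg_le p" "y \<in> deg_le r"
  then have "int (length (letters (v + w))) \<le> p + r"
    if "v \<in> Poly_Mapping.keys x" "w \<in> Poly_Mapping.keys y" for v w
    using that add_mono by (fastforce simp: deg_le_def plus_word_def)
  then show ?thesis
    using keys_mult[of x y] unfolding deg_le_def by blast
qed

lemma deg_le_e_basis: "e_basis m \<in> deg_le 1"
  by (simp add: deg_le_def e_basis_def)

section \<open>Homogeneous components\<close>

definition homog :: "nat \<Rightarrow> 'k::field tensors \<Rightarrow> 'k tensors" where
  "homog p x = Poly_Mapping.mapp (\<lambda>w c. c when length (letters w) = p) x"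

lemma lookup_homog:
  "Poly_Mapping.lookup (homog p x) w = (Poly_Mapping.lookup x w when length (letters w) = p)"
  by (simp add: homog_def lookup_mapp in_keys_iff when_def)

lemma homog_zero [simp]: "homog p 0 = 0"
  and homog_add: "homog p (x + y) = homog p x + homog p y"
  and homog_diff: "homog p (x - y) = homog p x - homog p y"
  and homog_scale: "homog p (scale c x) = scale c (homog p x)"
  and homog_homog: "homog p (homog r x) = (homog r x when p = r)"
  by (rule poly_mapping_eqI; simp add: lookup_homog lookup_add lookup_minus lookup_scale when_def)+

lemma homog_single:
  "homog p (Poly_Mapping.single w c) = (Poly_Mapping.single w c when length (letters w) = p)"
  by (rule poly_mapping_eqI) (simp add: lookup_homog lookup_single when_def)

lemma letters_zero [simp]: "letters 0 = []"
  by (simp add: zero_word_def)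

lemma homog_one: "homog p 1 = (1 when p = 0)"
  using homog_single[of p 0 1] by (auto simp: when_def)

lemma homog_e_basis: "homog p (e_basis m) = (e_basis m when p = 1)"
  by (auto simp: e_basis_def homog_single when_def)

lemma homog_e_mult_e: "homog p (e_basis m * e_basis n) = (e_basis m * e_basis n when p = 2)"
  by (auto simp: e_times_e homog_single when_def)

lemma homog_sum: "homog p (sum f S) = (\<Sum>i\<in>S. homog p (f i))"
  by (induction S rule: infinite_finite_induct) (auto simp: homog_add)

lemma homog_deg_le: "homog p x \<in> deg_le (int p)"
  by (simp add: deg_le_iff lookup_homog)

lemma diff_homog_deg_le: "x \<in> deg_le (int p) \<Longrightarrow> x - homog p x \<in> deg_le (int p - 1)"
  by (simp add: deg_le_iff lookup_homog lookup_minus when_def)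

lemma finite_homog_support: "finite {p. homog p x \<noteq> 0}"
proof (rule finite_subset)
  show "{p. homog p x \<noteq> 0} \<subseteq> (length \<circ> letters) ` Poly_Mapping.keys x"
  proof
    fix p assume "p \<in> {p. homog p x \<noteq> 0}"
    then obtain w where "Poly_Mapping.lookup (homog p x) w \<noteq> 0"
      by (metis (mono_tags) lookup_zero mem_Collect_eq poly_mapping_eqI)
    then show "p \<in> (length \<circ> letters) ` Poly_Mapping.keys x"
      by (auto simp: lookup_homog in_keys_iff image_iff when_def split: if_splits)
  qed
qed simp

text \<open>Word length is additive under concatenation, so \<open>T(U)\<close> is graded by
  it.\<close>

lemma homog_mult: "homog p (x * y) = (\<Sum>i\<le>p. homog i x * homog (p - i) y)"
proof (induction x rule: poly_mapping_add_induct)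
  case (single v a)
  show ?case
  proof (induction y rule: poly_mapping_add_induct)
    case (single w b)
    \<comment> \<open>Only the index \<open>i = length (letters v)\<close> can contribute; if it
      exceeds \<open>p\<close>, both sides vanish.\<close>
    have "(\<Sum>i\<le>p. homog i (Poly_Mapping.single v a) * homog (p - i) (Poly_Mapping.single w b)) =
      (\<Sum>i\<le>p. if i = length (letters v)
        then Poly_Mapping.single v a * homog (p - i) (Poly_Mapping.single w b) else 0)"
      by (intro sum.cong) (auto simp: homog_single when_def)
    also have "\<dots> = homog p (Poly_Mapping.single v a * Poly_Mapping.single w b)"
      by (auto simp: homog_single mult_single when_def plus_word_def)
    finally show ?case by simp
  next
    case (add y z)
    then show ?case by (simp add: homog_add distrib_left sum.distrib)
  qed
next
  case (add x z)
  then show ?case by (simp add: homog_add distrib_right sum.distrib)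
qed


subsection \<open>Quotients of the tensor algebra\<close>

lemma tensor_alg_simps [simp]:
  "carrier tensor_alg = UNIV" "mult tensor_alg = (*)" "one tensor_alg = 1"
  "zero tensor_alg = 0" "add tensor_alg = (+)" "smult tensor_alg = scale"
  by (simp_all add: tensor_alg_def)

lemma ring_tensor_alg: "ring (tensor_alg :: ('k::field, 'k tensors) module)"
  by (intro ringI abelian_groupI monoidI)
    (auto simp: algebra_simps intro: exI[of _ "- x" for x] add.left_inverse)

text \<open>Closure under negation comes from multiplication by \<open>- 1\<close>.\<close>

lemma ideal_tensor_algI:
  fixes N :: "'k::field tensors set"
  assumes "0 \<in> N" "\<And>x y. x \<in> N \<Longrightarrow> y \<in> N \<Longrightarrow> x + y \<in> N"
    and mult: "\<And>x y. x \<in> N \<Longrightarrow> y * x \<in> N" "\<And>x y. x \<in> N \<Longrightarrow> x * y \<in> N"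
  shows "ideal N tensor_alg"
proof -
  have grp: "Group.group (add_monoid (tensor_alg :: ('k, 'k tensors) module))"
    using ring_tensor_alg by (intro abelian_group.a_group ring.is_abelian_group)
  have "subgroup N (add_monoid tensor_alg)"
  proof (rule group.subgroupI[OF grp])
    fix x assume "x \<in> N"
    moreover have "inv\<^bsub>add_monoid tensor_alg\<^esub> x = - 1 * x"
      using grp by (intro group.inv_equality) auto
    ultimately show "inv\<^bsub>add_monoid tensor_alg\<^esub> x \<in> N" using mult(1)[of x "- 1"] by simp
  qed (use assms in auto)
  then show ?thesis
    by (intro idealI ring_tensor_alg) (use mult in auto)
qed

text \<open>Set up for an arbitrary ideal, so that both the quadratic and the Witt ideal become
  instances.\<close>

locale tensor_ideal =
  fixes J :: "'k::field tensors set"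
  assumes ideal: "ideal J tensor_alg"
begin

lemma zero_mem: "0 \<in> J"
  using ideal additive_subgroup.zero_closed ideal.axioms(1) by fastforce

lemma add_mem: "x \<in> J \<Longrightarrow> y \<in> J \<Longrightarrow> x + y \<in> J"
  using additive_subgroup.a_closed[OF ideal.axioms(1)[OF ideal]] by simp

lemma mult_mem_left: "x \<in> J \<Longrightarrow> y * x \<in> J"
  using ideal.I_l_closed[OF ideal] by simp

lemma mult_mem_right: "x \<in> J \<Longrightarrow> x * y \<in> J"
  using ideal.I_r_closed[OF ideal] by simp

lemma uminus_mem: "x \<in> J \<Longrightarrow> - x \<in> J"
  using mult_mem_left[of x "-1"] by simp

lemma diff_mem: "x \<in> J \<Longrightarrow> y \<in> J \<Longrightarrow> x - y \<in> J"
  using add_mem[of x "- y"] uminus_mem by simp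

lemma scale_mem: "x \<in> J \<Longrightarrow> scale c x \<in> J"
  by (simp add: scale_eq_mult mult_mem_left)

abbreviation cls :: "'k tensors \<Rightarrow> 'k tensors set" where
  "cls x \<equiv> J +>\<^bsub>tensor_alg\<^esub> x"

abbreviation A :: "('k, 'k tensors set) module" where
  "A \<equiv> quot_alg tensor_alg J"

lemma mem_cls: "y \<in> cls x \<longleftrightarrow> y - x \<in> J"
  by (auto simp: a_r_coset_def' intro: bexI[of _ "y - x"])

lemma cls_eq_iff: "cls x = cls y \<longleftrightarrow> x - y \<in> J"
proof
  assume "cls x = cls y"
  then show "x - y \<in> J"
    using mem_cls[of x x] mem_cls[of x y] zero_mem by simp
next
  assume *: "x - y \<in> J"
  show "cls x = cls y"
  proof (rule Set.set_eqI)
    fix z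
    show "z \<in> cls x \<longleftrightarrow> z \<in> cls y"
      using add_mem[OF _ *, of "z - x"] diff_mem[OF _ *, of "z - y"] by (auto simp: mem_cls)
  qed
qed

lemma carrier_A: "carrier A = range cls"
  by (auto simp: quot_alg_def FactRing_def A_RCOSETS_def')

lemma zero_A: "zero A = cls 0"
  by (auto simp: quot_alg_def FactRing_def mem_cls)

lemma one_A: "one A = cls 1"
  by (simp add: quot_alg_def FactRing_def)

lemma mult_A: "cls x \<otimes>\<^bsub>A\<^esub> cls y = cls (x * y)"
  using ideal.rcoset_mult_add[OF ideal, of x y] by (simp add: quot_alg_def FactRing_def)

lemma add_A: "cls x \<oplus>\<^bsub>A\<^esub> cls y = cls (x + y)"
  using abelian_subgroup.a_rcos_sum[OF abelian_subgroupI3, of J tensor_alg x y]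
    ideal ring.is_abelian_group[OF ring_tensor_alg]
  by (simp add: quot_alg_def FactRing_def ideal.axioms(1))

text \<open>\<open>quot_alg\<close> unites over all representatives of the coset; they all yield the
  same coset because \<open>J\<close> is closed under scaling.\<close>

lemma smult_A: "c \<odot>\<^bsub>A\<^esub> cls x = cls (scale c x)"
proof -
  have "cls (scale c y) = cls (scale c x)" if "y \<in> cls x" for y
    using that by (simp add: cls_eq_iff mem_cls scale_mem flip: scale_diff_right)
  moreover have "x \<in> cls x" by (simp add: mem_cls zero_mem)
  ultimately have "(\<Union>y\<in>cls x. cls (scale c y)) = cls (scale c x)" by blast
  then show ?thesis by (simp add: quot_alg_def)
qed

text \<open>Serves to evaluate the finite sums in \<open>A\<close> that occur in the product of
  \<open>assoc_graded\<close>.\<close>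

lemma abelian_group_A: "abelian_group A"
proof (rule abelian_groupI)
  fix X assume "X \<in> carrier A"
  then obtain x where "X = cls x" by (auto simp: carrier_A)
  then show "\<exists>y\<in>carrier A. y \<oplus>\<^bsub>A\<^esub> X = \<zero>\<^bsub>A\<^esub>"
    by (intro bexI[of _ "cls (- x)"]) (simp_all add: carrier_A zero_A add_A)
qed (auto simp: carrier_A zero_A add_A algebra_simps)

lemma finsum_A:
  assumes "finite S"
  shows "(\<Oplus>\<^bsub>A\<^esub>i\<in>S. cls (f i)) = cls (\<Sum>i\<in>S. f i)"
proof -
  interpret abelian_group A by (rule abelian_group_A)
  show ?thesis
    using assms by (induction S) (auto simp: finsum_insert carrier_A zero_A add_A)
qed


subsection \<open>The associated graded algebra of a quotient of the tensor algebra\<close>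

abbreviation fil :: "int \<Rightarrow> 'k tensors set set" where
  "fil p \<equiv> {cls x | x. x \<in> deg_le p}"

abbreviation Gr :: "('k, nat \<Rightarrow> 'k tensors set set) module" where
  "Gr \<equiv> assoc_graded A fil"

text \<open>The class of \<open>x\<close> in degree \<open>p\<close>. The subtraction is taken in
  the integers, so for \<open>p = 0\<close> the subgroup is \<open>fil (- 1)\<close>, which contains
  only \<open>cls 0\<close>.\<close>

abbreviation sym :: "nat \<Rightarrow> 'k tensors \<Rightarrow> 'k tensors set set" where
  "sym p x \<equiv> fil (int p - 1) +>\<^bsub>A\<^esub> cls x"

lemma sym_eq: "sym p x = {cls (x + y) | y. y \<in> deg_le (int p - 1)}"
proof -
  have coset: "H +>\<^bsub>A\<^esub> X = {h \<oplus>\<^bsub>A\<^esub> X | h. h \<in> H}" for H X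
    unfolding a_r_coset_def' by blast
  have "cls (x + y) = cls y \<oplus>\<^bsub>A\<^esub> cls x" for y
    by (simp add: add_A add.commute)
  then show ?thesis
    unfolding coset by auto
qed

text \<open>Turns equality in \<open>Gr\<close> into membership in \<open>J\<close>. The freedom in
  \<open>y\<close> is what lets the linear tail of a Witt relation disappear.\<close>

lemma sym_eq_iff: "sym p x = sym p x' \<longleftrightarrow> (\<exists>y\<in>deg_le (int p - 1). x - x' - y \<in> J)"
proof
  assume "sym p x = sym p x'"
  moreover have "cls x \<in> sym p x"
    unfolding sym_eq by (auto intro: exI[of _ 0] simp: deg_le_zero)
  ultimately have "cls x \<in> sym p x'" by simp
  then show "\<exists>y\<in>deg_le (int p - 1). x - x' - y \<in> J"
    unfolding sym_eq by (auto simp: cls_eq_iff algebra_simps)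
next
  \<comment> \<open>One inclusion suffices: the other one is its instance with \<open>x\<close> and
    \<open>x'\<close> exchanged and \<open>- y\<close> for \<open>y\<close>.\<close>
  have *: "sym p x \<subseteq> sym p x'" if "y \<in> deg_le (int p - 1)" "x - x' - y \<in> J" for x x' y
  proof -
    have "cls (x + z) = cls (x' + (z + y))" for z
      using that by (simp add: cls_eq_iff algebra_simps)
    then show ?thesis
      unfolding sym_eq using that(1) by (auto intro: deg_le_add)
  qed
  assume "\<exists>y\<in>deg_le (int p - 1). x - x' - y \<in> J"
  then obtain y where y: "y \<in> deg_le (int p - 1)" "x - x' - y \<in> J" by auto
  have "- y \<in> deg_le (int p - 1)" using deg_le_diff[OF deg_le_zero y(1)] by simp
  moreover have "x' - x - - y \<in> J" using uminus_mem[OF y(2)] by (simp add: algebra_simps)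
  ultimately show "sym p x = sym p x'" using * y by (meson subset_antisym)
qed

lemma sym_zero: "sym p 0 = fil (int p - 1)"
  unfolding sym_eq by simp

lemma gr_class_eq: "gr_class A fil n (cls x) = (\<lambda>p. sym p (if p = n then x else 0))"
  by (auto simp: gr_class_def sym_zero fun_eq_iff)

text \<open>This is the map \<sigma>. All homogeneous components are kept, not only the leading one,
  which makes it additive.\<close>

definition symbols :: "'k tensors \<Rightarrow> nat \<Rightarrow> 'k tensors set set" where
  "symbols x p = sym p (homog p x)"

lemma symbols_mem: "symbols x \<in> carrier Gr"
proof -
  have "{p. symbols x p \<noteq> fil (int p - 1)} \<subseteq> {p. homog p x \<noteq> 0}"
    by (auto simp: symbols_def sym_zero)
  then have "finite {p. symbols x p \<noteq> fil (int p - 1)}"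
    using finite_homog_support finite_subset by blast
  moreover have "\<exists>X. symbols x p = fil (int p - 1) +>\<^bsub>A\<^esub> X \<and> X \<in> fil (int p)" for p
    unfolding symbols_def using homog_deg_le by blast
  ultimately show ?thesis by (simp add: assoc_graded_def)
qed

text \<open>Each component of \<open>f\<close> has a homogeneous representative, and the finitely
  many nontrivial ones are summed.\<close>

lemma symbols_surj:
  assumes "f \<in> carrier Gr"
  obtains x where "f = symbols x"
proof -
  \<comment> \<open>The second conjunct forces representative 0 off the support of \<open>f\<close>,
    so the sum over the support misses nothing.\<close>
  have "\<exists>x. f p = sym p (homog p x) \<and> (f p = fil (int p - 1) \<longrightarrow> x = 0)" for p
  proof (cases "f p = fil (int p - 1)")
    case True
    then show ?thesis by (intro exI[of _ 0]) (simp add: sym_zero)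
  next
    case False
    from assms have "f p \<in> {fil (int p - 1) +>\<^bsub>A\<^esub> X | X. X \<in> fil (int p)}"
      by (simp add: assoc_graded_def)
    then obtain x where x: "x \<in> deg_le (int p)" "f p = sym p x" by blast
    have "sym p x = sym p (homog p x)"
      unfolding sym_eq_iff using diff_homog_deg_le[OF x(1)] zero_mem
      by (intro bexI[of _ "x - homog p x"]) simp_all
    with x(2) have "f p = sym p (homog p x)" by (rule trans)
    then show ?thesis using False by blast
  qed
  then have "\<exists>x. \<forall>p. f p = sym p (homog p (x p)) \<and> (f p = fil (int p - 1) \<longrightarrow> x p = 0)"
    by (intro choice allI)
  then obtain x where x: "\<And>p. f p = sym p (homog p (x p))"
    "\<And>p. f p = fil (int p - 1) \<Longrightarrow> x p = 0" by blast
  define S where "S = {p. f p \<noteq> fil (int p - 1)}"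
  have "finite S" using assms by (simp add: S_def assoc_graded_def)
  have "f p = symbols (\<Sum>i\<in>S. homog i (x i)) p" for p
  proof -
    have "homog p (\<Sum>i\<in>S. homog i (x i)) = (\<Sum>i\<in>S. if i = p then homog i (x i) else 0)"
      by (auto simp: homog_sum homog_homog when_def intro!: sum.cong)
    also have "\<dots> = homog p (x p)"
    proof (cases "p \<in> S")
      case True
      then show ?thesis using \<open>finite S\<close> by simp
    next
      case False
      then have "x p = 0" using x(2) by (simp add: S_def)
      then show ?thesis using False \<open>finite S\<close> by simp
    qed
    finally show ?thesis unfolding symbols_def using x(1) by simp
  qed
  then have "f = symbols (\<Sum>i\<in>S. homog i (x i))" by (rule ext)
  then show thesis by (rule that)
qed

text \<open>The product in \<open>Gr\<close> is a union over all choices of representatives. Every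
  choice gives the same coset and at least one choice exists, so the union is that coset.\<close>

lemma symbols_mult: "symbols x \<otimes>\<^bsub>Gr\<^esub> symbols y = symbols (x * y)"
proof
  fix p
  let ?reps = "{(X, Y). (\<forall>i. X i \<in> symbols x i) \<and> (\<forall>i. Y i \<in> symbols y i)}"
  have eq: "fil (int p - 1) +>\<^bsub>A\<^esub> (\<Oplus>\<^bsub>A\<^esub>i\<in>{..p}. X i \<otimes>\<^bsub>A\<^esub> Y (p - i)) = symbols (x * y) p"
    if "(X, Y) \<in> ?reps" for X Y
  proof -
    from that have "\<forall>i. \<exists>d\<in>deg_le (int i - 1). X i = cls (homog i x + d)"
      "\<forall>i. \<exists>d\<in>deg_le (int i - 1). Y i = cls (homog i y + d)"
      by (force simp: symbols_def sym_eq)+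
    then obtain d e where
      d: "\<And>i. d i \<in> deg_le (int i - 1)" "\<And>i. X i = cls (homog i x + d i)" and
      e: "\<And>i. e i \<in> deg_le (int i - 1)" "\<And>i. Y i = cls (homog i y + e i)"
      by metis
    \<comment> \<open>The error caused by the lower-order terms \<open>d\<close> and
      \<open>e\<close>: each summand contains one of them and so loses at least one degree.\<close>
    let ?l = "\<lambda>i. homog i x * e (p - i) + d i * (homog (p - i) y + e (p - i))"
    have l: "?l i \<in> deg_le (int p - 1)" if "i \<le> p" for i
    proof -
      have "homog i x * e (p - i) \<in> deg_le (int i + (int (p - i) - 1))"
        by (intro deg_le_mult homog_deg_le e)
      moreover have "d i * (homog (p - i) y + e (p - i)) \<in> deg_le (int i - 1 + int (p - i))"
        by (intro deg_le_mult deg_le_add homog_deg_le d deg_le_mono[OF e(1)]) simp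
      ultimately show ?thesis
        using that by (intro deg_le_add) (auto elim!: deg_le_mono)
    qed
    have "(\<Oplus>\<^bsub>A\<^esub>i\<in>{..p}. X i \<otimes>\<^bsub>A\<^esub> Y (p - i)) =
      cls (\<Sum>i\<le>p. (homog i x + d i) * (homog (p - i) y + e (p - i)))"
      by (simp add: d e mult_A finsum_A)
    also have "(\<Sum>i\<le>p. (homog i x + d i) * (homog (p - i) y + e (p - i))) =
      homog p (x * y) + (\<Sum>i\<le>p. ?l i)"
      by (simp add: homog_mult algebra_simps sum.distrib)
    also have "sym p \<dots> = sym p (homog p (x * y))"
      unfolding sym_eq_iff using l zero_mem
      by (intro bexI[of _ "\<Sum>i\<le>p. ?l i"]) (auto intro!: deg_le_sum)
    finally show ?thesis by (simp add: symbols_def)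
  qed
  \<comment> \<open>The homogeneous components themselves are one admissible choice.\<close>
  have "cls (homog i z) \<in> symbols z i" for i z
    unfolding symbols_def sym_eq using deg_le_zero by force
  then have "((\<lambda>i. cls (homog i x)), (\<lambda>i. cls (homog i y))) \<in> ?reps" by simp
  then have "?reps \<noteq> {}" by auto
  then have "(\<Union>(X, Y)\<in>?reps. fil (int p - 1) +>\<^bsub>A\<^esub> (\<Oplus>\<^bsub>A\<^esub>i\<in>{..p}. X i \<otimes>\<^bsub>A\<^esub> Y (p - i)))
    = symbols (x * y) p"
  proof (rule SUP_eq_const)
    fix z assume "z \<in> ?reps"
    then show "(case z of (X, Y) \<Rightarrow> fil (int p - 1) +>\<^bsub>A\<^esub> (\<Oplus>\<^bsub>A\<^esub>i\<in>{..p}. X i \<otimes>\<^bsub>A\<^esub> Y (p - i)))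
      = symbols (x * y) p"
      using eq by (cases z) simp
  qed
  then show "(symbols x \<otimes>\<^bsub>Gr\<^esub> symbols y) p = symbols (x * y) p"
    by (simp add: assoc_graded_def)
qed

lemma symbols_add: "symbols x \<oplus>\<^bsub>Gr\<^esub> symbols y = symbols (x + y)"
proof
  fix p
  have "sym p u <+>\<^bsub>A\<^esub> sym p v = sym p (u + v)" for u v
  proof (intro Set.set_eqI iffI)
    fix Z assume "Z \<in> sym p u <+>\<^bsub>A\<^esub> sym p v"
    then obtain d e where "d \<in> deg_le (int p - 1)" "e \<in> deg_le (int p - 1)"
      "Z = cls (u + d) \<oplus>\<^bsub>A\<^esub> cls (v + e)"
      by (auto simp: sym_eq set_add_def')
    then show "Z \<in> sym p (u + v)"
      unfolding sym_eq add_A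
      by (auto intro!: exI[of _ "d + e"] deg_le_add simp: algebra_simps)
  next
    fix Z assume "Z \<in> sym p (u + v)"
    then obtain d where d: "d \<in> deg_le (int p - 1)" "Z = cls (u + v + d)"
      by (auto simp: sym_eq)
    \<comment> \<open>The whole lower-order term is assigned to the second summand.\<close>
    then have "Z = cls (u + 0) \<oplus>\<^bsub>A\<^esub> cls (v + d)" by (simp add: add_A add.assoc)
    then show "Z \<in> sym p u <+>\<^bsub>A\<^esub> sym p v"
      unfolding sym_eq set_add_def' using d(1) deg_le_zero by blast
  qed
  then show "(symbols x \<oplus>\<^bsub>Gr\<^esub> symbols y) p = symbols (x + y) p"
    by (simp add: assoc_graded_def symbols_def homog_add)
qed

lemma symbols_smult: "c \<odot>\<^bsub>Gr\<^esub> symbols x = symbols (scale c x)"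
proof
  fix p
  have eq: "fil (int p - 1) +>\<^bsub>A\<^esub> (c \<odot>\<^bsub>A\<^esub> X) = symbols (scale c x) p" if X: "X \<in> symbols x p" for X
  proof -
    from X obtain d where d: "d \<in> deg_le (int p - 1)" "X = cls (homog p x + d)"
      by (auto simp: symbols_def sym_eq)
    have "sym p (scale c (homog p x + d)) = sym p (homog p (scale c x))"
      unfolding sym_eq_iff using d(1) zero_mem
      by (intro bexI[of _ "scale c d"]) (auto simp: scale_add_right homog_scale deg_le_scale)
    then show ?thesis by (simp add: d(2) smult_A symbols_def)
  qed
  have "cls (homog p x) \<in> symbols x p"
    unfolding symbols_def sym_eq using deg_le_zero by force
  then have "symbols x p \<noteq> {}" by (metis empty_iff)
  then have "(\<Union>X\<in>symbols x p. fil (int p - 1) +>\<^bsub>A\<^esub> (c \<odot>\<^bsub>A\<^esub> X)) = symbols (scale c x) p"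
    by (rule SUP_eq_const) (rule eq)
  then show "(c \<odot>\<^bsub>Gr\<^esub> symbols x) p = symbols (scale c x) p"
    by (simp add: assoc_graded_def)
qed

lemma symbols_one: "symbols 1 = \<one>\<^bsub>Gr\<^esub>"
  by (simp add: assoc_graded_def one_A gr_class_eq symbols_def fun_eq_iff homog_one when_def)

lemma symbols_e_basis: "symbols (e_basis k) = gr_class A fil 1 (cls (e_basis k))"
  by (simp add: gr_class_eq symbols_def fun_eq_iff homog_e_basis when_def)

lemma symbols_in_alg_hom: "symbols \<in> alg_hom tensor_alg Gr"
  by (simp add: alg_hom_def ring_hom_def symbols_mem symbols_mult symbols_add symbols_smult
      symbols_one)

lemma symbols_eq_iff:
  "symbols x = symbols y \<longleftrightarrow>
    (\<forall>p. \<exists>d\<in>deg_le (int p - 1). homog p x - homog p y - d \<in> J)"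
  by (simp add: fun_eq_iff symbols_def sym_eq_iff)

text \<open>With the kernel an ideal, vanishing on an ideal generated by relations can be checked on
  the generators.\<close>

lemma ideal_kernel_symbols: "ideal {x. symbols x = symbols 0} tensor_alg"
proof -
  \<comment> \<open>A factor whose symbols are those of 0 may be replaced by 0 before
    multiplying.\<close>
  have mult: "symbols (x * y) = symbols 0" if "symbols x = symbols 0 \<or> symbols y = symbols 0" for x y
    using that symbols_mult[of x y] symbols_mult[of 0 y] symbols_mult[of x 0] by auto
  have add: "symbols (x + y) = symbols 0" if "symbols x = symbols 0" "symbols y = symbols 0" for x y
    using that symbols_add[of x y] symbols_add[of 0 0] by simp
  show ?thesis
    by (rule ideal_tensor_algI) (auto intro: mult add)
qed

end


subsection \<open>Homomorphisms out of the tensor algebra\<close>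

text \<open>The uniqueness half of the universal property of \<open>T(U)\<close>: every word is a
  product of generators, and words span.\<close>

lemma alg_hom_tensor_alg_eqI:
  assumes g: "g \<in> alg_hom tensor_alg B" and h: "h \<in> alg_hom tensor_alg B"
    and e: "\<And>k. g (e_basis k) = h (e_basis k)"
  shows "g x = h x"
proof (induction x rule: poly_mapping_add_induct)
  case (single w c)
  have word: "g (Poly_Mapping.single (Word ls) 1) = h (Poly_Mapping.single (Word ls) 1)" for ls
  proof (induction ls)
    case Nil
    have "Poly_Mapping.single (Word []) 1 = (1 :: 'a tensors)" by (simp flip: zero_word_def)
    then show ?case using g h by (simp add: alg_hom_def ring_hom_def)
  next
    case (Cons a ls)
    have "Poly_Mapping.single (Word (a # ls)) 1 =
      (e_basis a * Poly_Mapping.single (Word ls) 1 :: 'a tensors)"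
      by (simp add: e_basis_def mult_single plus_word_def)
    then show ?case using g h e Cons by (simp add: alg_hom_def ring_hom_def)
  qed
  have "Poly_Mapping.single w c = scale c (Poly_Mapping.single w 1)"
    by (simp add: scale_eq_mult mult_single)
  then show ?case using g h word[of "letters w"] by (simp add: alg_hom_def)
next
  case (add x y)
  then show ?case using g h by (simp add: alg_hom_def ring_hom_def)
qed

lemma (in tensor_ideal) alg_hom_comp_cls:
  assumes "\<phi> \<in> alg_hom A B"
  shows "(\<lambda>x. \<phi> (cls x)) \<in> alg_hom tensor_alg B"
  using assms
  by (auto simp: alg_hom_def ring_hom_def carrier_A one_A simp flip: mult_A add_A smult_A)

text \<open>The map picks any representative of the coset, and \<open>ker\<close> makes the choice
  immaterial. Since \<open>B\<close> is an arbitrary record, \<open>ker\<close> speaks of congruent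
  elements instead of a kernel.\<close>

lemma (in tensor_ideal) alg_hom_factor:
  assumes h: "h \<in> alg_hom tensor_alg B" and ker: "\<And>x y. x - y \<in> J \<Longrightarrow> h x = h y"
  obtains \<phi> where "\<phi> \<in> alg_hom A B" "\<And>x. \<phi> (cls x) = h x"
proof -
  define \<phi> where "\<phi> X = h (SOME x. x \<in> X)" for X
  have eq: "\<phi> (cls x) = h x" for x
  proof -
    have "x \<in> cls x" by (simp add: mem_cls zero_mem)
    then have "(SOME y. y \<in> cls x) \<in> cls x" by (rule someI)
    then show ?thesis unfolding \<phi>_def by (intro ker) (simp add: mem_cls)
  qed
  have "\<phi> \<in> alg_hom A B"
    using h by (auto simp: alg_hom_def ring_hom_def carrier_A one_A mult_A add_A smult_A eq)
  then show thesis using eq that by blast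
qed


subsection \<open>The q-Witt algebra\<close>

lemma tensor_ideal_Idl: "tensor_ideal (Idl\<^bsub>tensor_alg\<^esub> S)"
  by (rule tensor_ideal.intro) (simp add: ring.genideal_ideal[OF ring_tensor_alg])

lemma Idl_subset: "ideal N tensor_alg \<Longrightarrow> S \<subseteq> N \<Longrightarrow> Idl\<^bsub>tensor_alg\<^esub> S \<subseteq> N"
  by (simp add: ring.genideal_minimal[OF ring_tensor_alg])

text \<open>An ideal is also a linear subspace, so it absorbs first the span of the relations and
  then the ideal generated by that span.\<close>

lemma quad_space_subset:
  assumes "ideal N tensor_alg" "\<And>m n. quad_rel q m n \<in> N"
  shows "Idl\<^bsub>tensor_alg\<^esub> (quad_space q) \<subseteq> N"
proof (rule Idl_subset[OF assms(1)])
  interpret tensor_ideal N by (rule tensor_ideal.intro) (rule assms)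
  show "quad_space q \<subseteq> N"
    unfolding quad_space_def
    by (rule module.span_minimal[OF module_scale])
      (use assms(2) in \<open>auto simp: module.subspace_def[OF module_scale] zero_mem add_mem scale_mem\<close>)
qed

interpretation quad: tensor_ideal "Idl\<^bsub>tensor_alg\<^esub> (quad_space q)" for q :: "'k::field"
  by (rule tensor_ideal_Idl)

interpretation witt: tensor_ideal "witt_ideal q" for q :: "'k::field"
  unfolding witt_ideal_def by (rule tensor_ideal_Idl)

lemma gr_witt_eq: "gr_witt q = witt.Gr q"
  by (simp add: gr_witt_def witt_alg_def witt_filtration_def [abs_def])

lemma witt_rel_mem: "witt_rel q m n \<in> witt_ideal q"
  unfolding witt_ideal_def
  using ring.genideal_self[OF ring_tensor_alg, of "{witt_rel q m n | m n. True}"] by auto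

text \<open>The relation is homogeneous of degree 2 and agrees modulo the Witt ideal with its linear
  tail \<open>?d\<close>, which is zero in degree 2 of the graded algebra.\<close>

lemma symbols_quad_rel: "witt.symbols q (quad_rel q m n) = witt.symbols q 0"
  unfolding witt.symbols_eq_iff
proof
  fix p
  have homog: "homog p (quad_rel q m n) = (quad_rel q m n when p = 2)"
    by (simp add: quad_rel_def homog_diff homog_scale homog_e_mult_e when_def)
  let ?d = "scale (q_int q (n + 1) - q_int q (m + 1)) (e_basis (m + n))"
  show "\<exists>d\<in>deg_le (int p - 1). homog p (quad_rel q m n) - homog p 0 - d \<in> witt_ideal q"
  proof (cases "p = 2")
    case True
    have "quad_rel q m n - ?d \<in> witt_ideal q"
      using witt_rel_mem[of q m n] by (simp add: witt_rel_def)
    moreover have "?d \<in> deg_le 1" by (intro deg_le_scale deg_le_e_basis)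
    ultimately show ?thesis using True homog by auto
  next
    case False
    then show ?thesis using homog by (auto intro!: bexI[of _ 0] simp: deg_le_zero witt.zero_mem)
  qed
qed

lemma symbols_eq_if_quad_equiv:
  assumes "x - y \<in> Idl\<^bsub>tensor_alg\<^esub> (quad_space q)"
  shows "witt.symbols q x = witt.symbols q y"
proof -
  have "Idl\<^bsub>tensor_alg\<^esub> (quad_space q) \<subseteq> {x. witt.symbols q x = witt.symbols q 0}"
    by (intro quad_space_subset witt.ideal_kernel_symbols) (simp add: symbols_quad_rel)
  then have "witt.symbols q (x - y) = witt.symbols q 0" using assms by auto
  \<comment> \<open>Adding \<open>y\<close> back replaces a subtraction in
    \<open>Gr\<close>.\<close>
  then have "witt.symbols q ((x - y) + y) = witt.symbols q (0 + y)"
    by (simp only: flip: witt.symbols_add)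
  then show ?thesis by simp
qed

lemma gr_class_witt:
  "gr_class (witt_alg q) (witt_filtration q) 1 (witt.cls q (e_basis k)) = witt.symbols q (e_basis k)"
  by (simp only: witt.symbols_e_basis witt_alg_def witt_filtration_def [abs_def])

text \<open>Existence keeps the later claims about all canonical homomorphisms from being
  vacuous.\<close>

lemma canonical_hom_exists: "\<exists>\<phi>. canonical_hom q \<phi>"
proof (rule quad.alg_hom_factor[OF witt.symbols_in_alg_hom symbols_eq_if_quad_equiv])
  fix \<phi>
  assume "\<phi> \<in> alg_hom (quad.A q) (witt.Gr q)" "\<And>x. \<phi> (quad.cls q x) = witt.symbols q x"
  then have "canonical_hom q \<phi>"
    unfolding canonical_hom_def gr_witt_eq quad_alg_def gr_class_witt by blast
  then show ?thesis by blast
qed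

text \<open>Composed with the projection from \<open>T(U)\<close>, the map agrees with \<sigma> on
  the generators, hence everywhere.\<close>

lemma canonical_hom_cls:
  assumes "canonical_hom q \<phi>"
  shows "\<phi> (quad.cls q x) = witt.symbols q x"
proof (rule alg_hom_tensor_alg_eqI)
  show "(\<lambda>x. \<phi> (quad.cls q x)) \<in> alg_hom tensor_alg (witt.Gr q)"
    using assms
    unfolding canonical_hom_def gr_witt_eq quad_alg_def by (intro quad.alg_hom_comp_cls) blast
  show "\<phi> (quad.cls q (e_basis k)) = witt.symbols q (e_basis k)" for k
    using assms unfolding canonical_hom_def gr_class_witt by blast
qed (rule witt.symbols_in_alg_hom)

lemma canonical_hom_surj:
  assumes "canonical_hom q \<phi>"
  shows "\<phi> ` carrier (quad_alg q) = carrier (gr_witt q)"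
proof -
  have "carrier (gr_witt q) = range (witt.symbols q)"
    unfolding gr_witt_eq using witt.symbols_mem witt.symbols_surj by blast
  then show ?thesis
    by (simp add: quad_alg_def quad.carrier_A image_image canonical_hom_cls[OF assms])
qed


subsection \<open>Failure of the PBW property\<close>

text \<open>The character of \<open>T(U)\<close> with \<open>e_basis k\<close> sent to 1 and the
  other generators to 0. The empty word passes the test too, so 1 goes to 1.\<close>

definition word_char :: "int \<Rightarrow> 'k::field tensors \<Rightarrow> 'k" where
  "word_char k x =
    (\<Sum>w\<in>Poly_Mapping.keys x. Poly_Mapping.lookup x w when set (letters w) \<subseteq> {k})"

lemma word_char_add: "word_char k (x + y) = word_char k x + word_char k y"
  unfolding word_char_def
  by (rule setsum_keys_plus_distrib) (auto simp: when_def)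

lemma word_char_single:
  "word_char k (Poly_Mapping.single w c) = (c when set (letters w) \<subseteq> {k})"
  by (simp add: word_char_def when_def)

lemma word_char_zero [simp]: "word_char k 0 = 0"
  by (simp add: word_char_def)

lemma word_char_mult: "word_char k (x * y) = word_char k x * word_char k y"
proof (induction x rule: poly_mapping_add_induct)
  case (single v a)
  show ?case
  proof (induction y rule: poly_mapping_add_induct)
    case (single w b)
    show ?case by (simp add: mult_single word_char_single plus_word_def when_def)
  next
    case (add y z)
    then show ?case by (simp add: word_char_add distrib_left)
  qed
next
  case (add x z)
  then show ?case by (simp add: word_char_add distrib_right)
qed

lemma word_char_diff: "word_char k (x - y) = word_char k x - word_char k y"
  using word_char_add[of k "x - y" y] by simp

lemma word_char_scale: "word_char k (scale c x) = c * word_char k x"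
  by (simp add: scale_eq_mult word_char_mult word_char_single)

lemma word_char_e_basis: "word_char k (e_basis m) = (1 when m = k)"
  by (simp add: e_basis_def word_char_single)

text \<open>On \<open>quad_rel q m n\<close> both products vanish unless \<open>m = n = k\<close>,
  and in that case the two terms cancel.\<close>

lemma word_char_quad_ideal:
  assumes "x \<in> Idl\<^bsub>tensor_alg\<^esub> (quad_space q)"
  shows "word_char k x = 0"
proof -
  have "Idl\<^bsub>tensor_alg\<^esub> (quad_space q) \<subseteq> {x. word_char k x = 0}"
    by (intro quad_space_subset ideal_tensor_algI)
      (auto simp: word_char_add word_char_mult quad_rel_def word_char_diff word_char_scale
        word_char_e_basis when_def)
  then show ?thesis using assms by auto
qed

text \<open>Scaling by \<open>q powi (- m - 1)\<close> makes the leading coefficient 1 and turns the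
  relation into a rewriting rule for \<open>e_basis m * e_basis n\<close>.\<close>

lemma normalized_witt_rel_mem:
  assumes "q \<noteq> 0"
  shows "e_basis m * e_basis n - scale (q powi (n - m)) (e_basis n * e_basis m)
    - scale (q_int q (n - m)) (e_basis (m + n)) \<in> witt_ideal q"
proof -
  have 1: "q powi (- m - 1) * q powi (m + 1) = 1"
    and 2: "q powi (- m - 1) * q powi (n + 1) = q powi (n - m)"
    using assms by (simp_all flip: power_int_add)
  have "q powi (- m - 1) * (q_int q (n + 1) - q_int q (m + 1)) =
    (q powi (- m - 1) * q powi (n + 1) - q powi (- m - 1) * q powi (m + 1)) / (q - 1)"
    by (simp add: q_int_def right_diff_distrib flip: diff_divide_distrib)
  then have 3: "q powi (- m - 1) * (q_int q (n + 1) - q_int q (m + 1)) = q_int q (n - m)"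
    unfolding 1 2 by (simp add: q_int_def)
  have "scale (q powi (- m - 1)) (witt_rel q m n) \<in> witt_ideal q"
    by (intro witt.scale_mem witt_rel_mem)
  then show ?thesis
    by (simp only: witt_rel_def quad_rel_def scale_diff_right scale_scale 1 2 3 scale_one)
qed

text \<open>The difference of the two ways of reordering \<open>e\<^sub>1 e\<^sub>2 e\<^sub>3\<close>; the cubic terms cancel.\<close>

definition pbw_obstruction :: "'k::field \<Rightarrow> 'k tensors" where
  "pbw_obstruction q =
    scale (q ^ 3) (e_basis 5 * e_basis 1) - e_basis 1 * e_basis 5
    + scale (q * (1 + q)) (e_basis 2 * e_basis 4 - e_basis 4 * e_basis 2)
    + scale (1 - q ^ 3) (e_basis 3 * e_basis 3)"

lemma pbw_obstruction_mem:
  assumes "q \<noteq> 0" "q \<noteq> 1"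
  shows "pbw_obstruction q \<in> witt_ideal q"
proof -
  \<comment> \<open>For \<open>q = 1\<close> the division by 0 would make these values 0.\<close>
  have q_int: "q_int q 1 = 1" "q_int q 2 = 1 + q"
    using assms(2) by (simp_all add: q_int_def divide_simps power2_eq_square algebra_simps)
  define r12 where "r12 = e_basis 1 * e_basis 2 - scale q (e_basis 2 * e_basis 1) - e_basis 3"
  define r13 where
    "r13 = e_basis 1 * e_basis 3 - scale (q ^ 2) (e_basis 3 * e_basis 1) - scale (1 + q) (e_basis 4)"
  define r23 where "r23 = e_basis 2 * e_basis 3 - scale q (e_basis 3 * e_basis 2) - e_basis 5"
  have r: "r12 \<in> witt_ideal q" "r13 \<in> witt_ideal q" "r23 \<in> witt_ideal q"
    using normalized_witt_rel_mem[OF assms(1), of 1 2] normalized_witt_rel_mem[OF assms(1), of 1 3]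
      normalized_witt_rel_mem[OF assms(1), of 2 3]
    by (simp_all add: r12_def r13_def r23_def q_int scale_one)
  \<comment> \<open>The first bracket swaps the letters 2 and 3 first, the second the letters 1 and
    2; the outer scalars are the powers of \<open>q\<close> accumulated by earlier swaps. Both have
    the cubic part \<open>e_basis 1 * e_basis 2 * e_basis 3\<close> minus \<open>q ^ 4\<close> times
    the reversed word.\<close>
  have "pbw_obstruction q =
    (e_basis 1 * r23 + scale q (r13 * e_basis 2) + scale (q ^ 2) (e_basis 3 * scale q r12))
    - (r12 * e_basis 3 + scale q (e_basis 2 * r13) + scale (q ^ 3) (r23 * e_basis 1))"
    unfolding pbw_obstruction_def r12_def r13_def r23_def
    by (simp add: algebra_simps scale_add_left scale_add_right scale_diff_right scale_diff_left
        scale_mult_left scale_mult_right scale_scale scale_one power2_eq_square power3_eq_cube)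
  also have "\<dots> \<in> witt_ideal q"
    by (intro witt.diff_mem witt.add_mem witt.scale_mem witt.mult_mem_left witt.mult_mem_right r)
  finally show ?thesis .
qed

lemma homog_pbw_obstruction: "homog p (pbw_obstruction q) = (pbw_obstruction q when p = 2)"
  by (simp add: pbw_obstruction_def homog_add homog_diff homog_scale homog_e_mult_e when_def)

text \<open>The element is homogeneous, so each of its components is either itself or 0 and lies in
  the Witt ideal without any lower-order correction.\<close>

lemma symbols_pbw_obstruction:
  assumes "q \<noteq> 0" "q \<noteq> 1"
  shows "witt.symbols q (pbw_obstruction q) = witt.symbols q 0"
  unfolding witt.symbols_eq_iff
  using pbw_obstruction_mem[OF assms]
  by (auto intro!: bexI[of _ 0] simp: deg_le_zero homog_pbw_obstruction when_def witt.zero_mem)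

text \<open>The character at 3 sees only the term \<open>e_basis 3 * e_basis 3\<close>, the one
  square of a generator in the element.\<close>

lemma pbw_obstruction_not_mem:
  assumes "q ^ 3 \<noteq> 1"
  shows "pbw_obstruction q \<notin> Idl\<^bsub>tensor_alg\<^esub> (quad_space q)"
proof
  assume "pbw_obstruction q \<in> Idl\<^bsub>tensor_alg\<^esub> (quad_space q)"
  then have "word_char 3 (pbw_obstruction q) = 0" by (rule word_char_quad_ideal)
  moreover have "word_char 3 (pbw_obstruction q) = 1 - q ^ 3"
    by (simp add: pbw_obstruction_def word_char_add word_char_diff word_char_scale word_char_mult
        word_char_e_basis)
  ultimately show False using assms by simp
qed

lemma canonical_hom_not_iso:
  assumes "q_generic q" "canonical_hom q \<phi>"
  shows "\<phi> \<notin> alg_iso (quad_alg q) (gr_witt q)"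
proof
  assume "\<phi> \<in> alg_iso (quad_alg q) (gr_witt q)"
  then have "inj_on \<phi> (range (quad.cls q))"
    by (simp add: alg_iso_def bij_betw_def quad_alg_def quad.carrier_A)
  \<comment> \<open>Genericity enters through the exponents 1 and 3.\<close>
  moreover have q: "q \<noteq> 0" "q \<noteq> 1" "q ^ 3 \<noteq> 1"
    using assms(1) by (auto simp: q_generic_def)
  have "\<phi> (quad.cls q (pbw_obstruction q)) = \<phi> (quad.cls q 0)"
    using symbols_pbw_obstruction[OF q(1,2)] by (simp add: canonical_hom_cls[OF assms(2)])
  ultimately have "quad.cls q (pbw_obstruction q) = quad.cls q 0"
    by (auto dest: inj_onD)
  then show False
    using pbw_obstruction_not_mem[OF q(3)] by (simp add: quad.cls_eq_iff)
qed

text \<open>The lemmas hold over an arbitrary field; both conjuncts are instances.\<close>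

theorem mainTheorem4:
  shows "(\<forall>q::complex. q_generic q \<longrightarrow>
            (\<exists>\<phi>. canonical_hom q \<phi>) \<and>
            (\<forall>\<phi>. canonical_hom q \<phi> \<longrightarrow>
                  \<phi> ` carrier (quad_alg q) = carrier (gr_witt q) \<and>
                  \<phi> \<notin> alg_iso (quad_alg q) (gr_witt q)))
       \<and> (\<forall>q::real. q_generic q \<longrightarrow>
            (\<exists>\<phi>. canonical_hom q \<phi>) \<and>
            (\<forall>\<phi>. canonical_hom q \<phi> \<longrightarrow>
                  \<phi> ` carrier (quad_alg q) = carrier (gr_witt q) \<and>
                  \<phi> \<notin> alg_iso (quad_alg q) (gr_witt q)))"
  by (simp add: canonical_hom_exists canonical_hom_surj canonical_hom_not_iso)

end
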